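(* Let $M:\mathbb{R}_+^2\to\mathbb{R}$ be a differentiable bivariate mean and, for each $p\in\mathbb{R}$, let $M_p:\mathbb{R}_+^2\to\mathbb{R}$ be defined by $$M_p(a,b)=\left(M(a^p,b^p)\right)^{1/p}\ \text{ if } p\neq 0,\qquad M_0(a,b)=a^{M_x(1,1)}\,b^{M_y(1,1)}.$$ Then $M_p$ is also a bivariate mean. In particular, if $M$ is symmetric, then $M_0=G$, where $G(a,b)=\sqrt{ab}$.
   Context: Here $\mathbb{R}_+=(0,\infty)$. A function $M:\mathbb{R}_+^2\to\mathbb{R}$ is called a bivariate mean if $\min(a,b)\le M(a,b)\le\max(a,b)$ for all $a,b>0$. It is symmetric if $M(a,b)=M(b,a)$ for all $a,b>0$. $M_x$ and $M_y$ denote the first-order partial derivatives of $M(x,y)$ with respect to its first and second argument, respectively. *)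

theory Defs
  imports "HOL-Analysis.Analysis"
begin

text \<open>
  A function on the open positive quadrant is represented by a total curried function on the
  reals; its values elsewhere are irrelevant, so every condition is restricted to positive
  arguments.
\<close>

definition bivariate_mean :: "(real \<Rightarrow> real \<Rightarrow> real) \<Rightarrow> bool" where
  "bivariate_mean M \<longleftrightarrow> (\<forall>a>0. \<forall>b>0. min a b \<le> M a b \<and> M a b \<le> max a b)"

definition symmetric_mean :: "(real \<Rightarrow> real \<Rightarrow> real) \<Rightarrow> bool" where
  "symmetric_mean M \<longleftrightarrow> (\<forall>a>0. \<forall>b>0. M a b = M b a)"

text \<open>
  Total (Frechet) differentiability on the quadrant. The quadrant is open, so this agrees with
  differentiability at each of its points in the whole plane.
\<close>

definition differentiable_mean :: "(real \<Rightarrow> real \<Rightarrow> real) \<Rightarrow> bool" where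
  "differentiable_mean M \<longleftrightarrow> (\<lambda>(x, y). M x y) differentiable_on ({0<..} \<times> {0<..})"

definition partial_x :: "(real \<Rightarrow> real \<Rightarrow> real) \<Rightarrow> real \<Rightarrow> real \<Rightarrow> real" where
  "partial_x M a b = deriv (\<lambda>x. M x b) a"

definition partial_y :: "(real \<Rightarrow> real \<Rightarrow> real) \<Rightarrow> real \<Rightarrow> real \<Rightarrow> real" where
  "partial_y M a b = deriv (\<lambda>y. M a y) b"

definition mean_power :: "(real \<Rightarrow> real \<Rightarrow> real) \<Rightarrow> real \<Rightarrow> real \<Rightarrow> real \<Rightarrow> real" where
  "mean_power M p a b =
     (if p \<noteq> 0 then M (a powr p) (b powr p) powr (1 / p)
      else a powr partial_x M 1 1 * b powr partial_y M 1 1)"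

definition geometric_mean :: "real \<Rightarrow> real \<Rightarrow> real" where
  "geometric_mean a b = sqrt (a * b)"

end

theory Submission
  imports Defs
begin

text \<open>
  A mean is a function that maps every box \<open>[l, u] \<times> [l, u]\<close> into \<open>[l, u]\<close>. For \<open>p \<noteq> 0\<close> the
  function \<open>mean_power M p\<close> is the conjugate of \<open>M\<close> by the monotone bijection \<open>x \<mapsto> x\<^sup>p\<close> of the
  positive half-line, and conjugation preserves that property, whether the bijection increases
  or decreases.

  For \<open>p = 0\<close> write \<open>\<alpha>\<close> and \<open>\<beta>\<close> for the partial derivatives of \<open>M\<close> at \<open>(1, 1)\<close>. Both are
  nonnegative, because the difference quotients of \<open>M\<close> there already are: \<open>M x 1\<close> lies between
  \<open>1\<close> and \<open>x\<close>, and so does \<open>M 1 x\<close>. Moreover \<open>\<alpha> + \<beta> = 1\<close>, by differentiating \<open>M t t = t\<close>; this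
  is where total differentiability, and not only the existence of the partial derivatives,
  enters. So \<open>mean_power M 0\<close> is a weighted geometric mean. Symmetry of \<open>M\<close> forces
  \<open>\<alpha> = \<beta> = 1/2\<close>, hence the weights of the geometric mean.
\<close>

lemma bivariate_mean_in_interval:
  assumes "bivariate_mean M" "0 < l" "a \<in> {l..u}" "b \<in> {l..u}"
  shows "M a b \<in> {l..u}"
proof -
  have "min a b \<le> M a b" "M a b \<le> max a b"
    using assms unfolding bivariate_mean_def by auto
  moreover have "l \<le> min a b" "max a b \<le> u"
    using assms by auto
  ultimately show ?thesis
    by auto
qed

lemma bivariate_mean_diagonal:
  assumes "bivariate_mean M" "0 < a"
  shows "M a a = a"
  using bivariate_mean_in_interval[OF assms(1), of a a a a] assms(2) by simp

lemma bivariate_mean_swap: "bivariate_mean M \<Longrightarrow> bivariate_mean (\<lambda>x y. M y x)"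
  unfolding bivariate_mean_def by (metis min.commute max.commute)

text \<open>
  A decreasing bijection exchanges the endpoints of an interval, so the negative exponents
  need the endpoints in the opposite order from the positive ones.
\<close>

lemma bivariate_mean_mean_power_nonzero:
  assumes M: "bivariate_mean M" and p: "p \<noteq> 0"
  shows "bivariate_mean (mean_power M p)"
  unfolding bivariate_mean_def
proof (intro allI impI)
  fix a b :: real
  assume ab: "0 < a" "0 < b"
  let ?l = "min a b" and ?u = "max a b" and ?m = "M (a powr p) (b powr p)"
  have pos: "0 < ?l" "0 < ?u"
    using ab by auto
  have cancel: "(x powr p) powr (1 / p) = x" if "0 < x" for x
    using that p by (simp add: powr_powr)
  have "?l \<le> ?m powr (1 / p) \<and> ?m powr (1 / p) \<le> ?u"
  proof (cases "0 < p")
    case True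
    have "?m \<in> {?l powr p..?u powr p}"
      using ab pos True by (intro bivariate_mean_in_interval[OF M]) (auto intro!: powr_mono2)
    then have "(?l powr p) powr (1 / p) \<le> ?m powr (1 / p)"
      "?m powr (1 / p) \<le> (?u powr p) powr (1 / p)"
      using True by (auto intro!: powr_mono2 intro: order_trans[OF powr_ge_zero])
    then show ?thesis
      using pos by (simp only: cancel)
  next
    case False
    with p have neg: "p \<le> 0" "1 / p \<le> 0"
      by auto
    have m: "?m \<in> {?u powr p..?l powr p}"
      using ab pos neg by (intro bivariate_mean_in_interval[OF M]) (auto intro!: powr_mono2')
    moreover have "0 < ?u powr p"
      using pos by simp
    ultimately have "0 < ?m"
      by (meson atLeastAtMost_iff less_le_trans)
    then have "(?l powr p) powr (1 / p) \<le> ?m powr (1 / p)"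
      "?m powr (1 / p) \<le> (?u powr p) powr (1 / p)"
      using m neg \<open>0 < ?u powr p\<close> by (auto intro!: powr_mono2' simp del: powr_gt_zero)
    then show ?thesis
      using pos by (simp only: cancel)
  qed
  then show "?l \<le> mean_power M p a b \<and> mean_power M p a b \<le> ?u"
    using p by (simp add: mean_power_def)
qed

lemma deriv_first_argument_nonneg:
  assumes M: "bivariate_mean M"
    and D: "((\<lambda>x. M x c) has_field_derivative d) (at c)" and c: "0 < c"
  shows "0 \<le> d"
proof (rule tendsto_lowerbound)
  show "((\<lambda>x. (M x c - M c c) / (x - c)) \<longlongrightarrow> d) (at c)"
    using D by (simp add: has_field_derivative_iff)
  have "0 \<le> (M x c - M c c) / (x - c)" if "0 < x" for x
  proof (cases "c \<le> x")
    case True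
    then show ?thesis
      using bivariate_mean_in_interval[OF M, of c x x c] bivariate_mean_diagonal[OF M c] c
      by simp
  next
    case False
    then show ?thesis
      using bivariate_mean_in_interval[OF M, of x x c c] bivariate_mean_diagonal[OF M c] that
      by (simp add: divide_nonpos_nonpos)
  qed
  moreover have "\<forall>\<^sub>F x in at c. 0 < x"
    using order_tendstoD(1)[OF tendsto_ident_at c] .
  ultimately show "\<forall>\<^sub>F x in at c. 0 \<le> (M x c - M c c) / (x - c)"
    by (auto elim: eventually_mono)
qed simp

text \<open>
  The three curves \<open>x \<mapsto> (x, c)\<close>, \<open>y \<mapsto> (c, y)\<close> and \<open>t \<mapsto> (t, t)\<close> pass through \<open>(c, c)\<close> with
  velocities \<open>(1, 0)\<close>, \<open>(0, 1)\<close> and their sum \<open>(1, 1)\<close>; linearity of the total derivative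
  relates the three derivatives along them.
\<close>

lemma differentiable_mean_partials:
  assumes M: "bivariate_mean M" and diff: "differentiable_mean M" and c: "0 < c"
  obtains "((\<lambda>x. M x c) has_field_derivative partial_x M c c) (at c)"
    and "((\<lambda>y. M c y) has_field_derivative partial_y M c c) (at c)"
    and "partial_x M c c + partial_y M c c = 1"
proof -
  let ?F = "\<lambda>(x, y). M x y"
  have "open ({0<..} \<times> {0<..} :: (real \<times> real) set)"
    by (intro open_Times open_greaterThan)
  then have "?F differentiable (at (c, c))"
    using diff c unfolding differentiable_mean_def
    by (simp add: differentiable_on_eq_differentiable_at)
  then obtain L where L: "(?F has_derivative L) (at (c, c))"
    unfolding differentiable_def by blast
  have linear: "linear L"
    using has_derivative_linear[OF L] .
  have curve: "((\<lambda>t. ?F (g t)) has_field_derivative L v) (at c)"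
    if g: "(g has_vector_derivative v) (at c)" and "g c = (c, c)" for g v
  proof -
    have "((\<lambda>t. ?F (g t)) has_derivative (\<lambda>h. L (h *\<^sub>R v))) (at c)"
      using has_derivative_compose[OF g[unfolded has_vector_derivative_def]] L that(2)
      by simp
    moreover have "(\<lambda>h. L (h *\<^sub>R v)) = (*) (L v)"
      by (simp add: fun_eq_iff linear_cmul[OF linear])
    ultimately show ?thesis
      by (simp add: has_field_derivative_def)
  qed
  have Dx: "((\<lambda>x. M x c) has_field_derivative L (1, 0)) (at c)"
    using curve[OF has_vector_derivative_Pair[OF has_vector_derivative_id has_vector_derivative_const]]
    by simp
  have Dy: "((\<lambda>y. M c y) has_field_derivative L (0, 1)) (at c)"
    using curve[OF has_vector_derivative_Pair[OF has_vector_derivative_const has_vector_derivative_id]]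
    by simp
  have "((\<lambda>t. M t t) has_field_derivative L (1, 1)) (at c)"
    using curve[OF has_vector_derivative_Pair[OF has_vector_derivative_id has_vector_derivative_id]]
    by simp
  moreover have "\<forall>\<^sub>F t in nhds c. M t t = t"
    using eventually_nhds_in_open[of "{0<..}" c] c
    by (auto elim!: eventually_mono simp: bivariate_mean_diagonal[OF M])
  ultimately have "((\<lambda>t. t) has_field_derivative L (1, 1)) (at c)"
    by (subst (asm) DERIV_cong_ev[OF refl _ refl])
  then have "L (1, 1) = 1"
    using DERIV_unique DERIV_ident by blast
  moreover have "L (1, 1) = L (1, 0) + L (0, 1)"
    using linear_add[OF linear, of "(1, 0)" "(0, 1)"] by simp
  ultimately show thesis
    using that Dx Dy by (simp add: partial_x_def partial_y_def DERIV_imp_deriv)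
qed

lemma weighted_geometric_mean_is_mean:
  fixes s t :: real
  assumes "0 \<le> s" "0 \<le> t" "s + t = 1"
  shows "bivariate_mean (\<lambda>a b. a powr s * b powr t)"
  unfolding bivariate_mean_def
proof (intro allI impI)
  fix a b :: real
  assume "0 < a" "0 < b"
  have diag: "x powr s * x powr t = x" if "0 < x" for x :: real
    using that assms(3) by (simp flip: powr_add)
  have "min a b powr s * min a b powr t \<le> a powr s * b powr t"
    "a powr s * b powr t \<le> max a b powr s * max a b powr t"
    using assms \<open>0 < a\<close> \<open>0 < b\<close> by (auto intro!: mult_mono powr_mono2)
  moreover have "0 < min a b" "0 < max a b"
    using \<open>0 < a\<close> \<open>0 < b\<close> by auto
  ultimately show "min a b \<le> a powr s * b powr t \<and> a powr s * b powr t \<le> max a b"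
    by (simp only: diag)
qed

lemma symmetric_mean_partials_eq:
  assumes "symmetric_mean M" "0 < c"
  shows "partial_x M c c = partial_y M c c"
proof -
  have "\<forall>\<^sub>F x in nhds c. M x c = M c x"
    using eventually_nhds_in_open[of "{0<..}" c] assms
    by (auto elim!: eventually_mono simp: symmetric_mean_def)
  then show ?thesis
    unfolding partial_x_def partial_y_def by (intro deriv_cong_ev) auto
qed

theorem theorem1:
  fixes M :: "real \<Rightarrow> real \<Rightarrow> real"
  assumes "bivariate_mean M"
    and "differentiable_mean M"
  shows "(\<forall>p. bivariate_mean (mean_power M p)) \<and>
    (symmetric_mean M \<longrightarrow> (\<forall>a>0. \<forall>b>0. mean_power M 0 a b = geometric_mean a b))"
proof (intro conjI allI impI)
  let ?s = "partial_x M 1 1" and ?t = "partial_y M 1 1"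
  have partials: "((\<lambda>x. M x 1) has_field_derivative ?s) (at 1)"
    "((\<lambda>y. M 1 y) has_field_derivative ?t) (at 1)" and sum: "?s + ?t = 1"
    using differentiable_mean_partials[OF assms zero_less_one] by blast+
  have nonneg: "0 \<le> ?s" "0 \<le> ?t"
    using deriv_first_argument_nonneg[OF assms(1) partials(1)]
      deriv_first_argument_nonneg[OF bivariate_mean_swap[OF assms(1)] partials(2)]
    by auto
  have power_zero: "mean_power M 0 = (\<lambda>a b. a powr ?s * b powr ?t)"
    by (simp add: mean_power_def fun_eq_iff)
  show "bivariate_mean (mean_power M p)" for p
  proof (cases "p = 0")
    case True
    then show ?thesis
      using weighted_geometric_mean_is_mean[OF nonneg sum] by (simp add: power_zero)
  next
    case False
    then show ?thesis
      using bivariate_mean_mean_power_nonzero[OF assms(1)] by blast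
  qed
  show "mean_power M 0 a b = geometric_mean a b"
    if "symmetric_mean M" "0 < a" "0 < b" for a b
  proof -
    have "?s = 1 / 2" "?t = 1 / 2"
      using symmetric_mean_partials_eq[OF that(1), of 1] sum by auto
    then show ?thesis
      unfolding power_zero geometric_mean_def
      using that by (simp only: powr_half_sqrt real_sqrt_mult less_imp_le)
  qed
qed

end
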